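(* Let $A\in\mathbb{R}^{m\times n}$, $\bm{b}\in\mathbb{R}^m$, $\sigma\ge 0$, $0\le p\le 1$ and $1\le q\le\infty$ be such that $\{\bm{x}\in\mathbb{R}^n:\|A\bm{x}-\bm{b}\|_q\le\sigma\}\neq\emptyset$ and $\|\bm{b}\|_q>\sigma$. For any $\bm{x}^*\in{\rm SOL}(A,\bm{b},\sigma,p,q)$, the following statements hold with $\mathcal{J}:=\mathrm{supp}(\bm{x}^* )$. (i) For $0<p\le 1$, $\|A\bm{x}^*-\bm{b}\|_q=\sigma$; and for $p=0$, there is a scalar $\alpha\in(0,1]$ such that $\|A(\alpha\bm{x}^* )-\bm{b}\|_q=\sigma$ and $\alpha'\bm{x}^*\in{\rm SOL}(A,\bm{b},\sigma,0,q)$ for any $\alpha'\in[\alpha,1]$. (ii) For $0\le p<1$, $\|\bm{x}^*\|_0=|\mathcal{J}|=\mathrm{rank}(A_{\mathcal{J}})$. (iii) For $0\le p<1$, $$\frac{(\|\bm{b}\|_q-\sigma)\,m^{\min\left\{\frac12-\frac1q,\,0\right\}}}{\sqrt{|\mathcal{J}|\,\lambda_{\max}(A_{\mathcal{J}}^{\top}A_{\mathcal{J}})}}\le\|\bm{x}^*\|_\infty\le\frac{\sigma\, m^{\max\left\{\frac12-\frac1q,\,0\right\}}+\|\bm{b}\|_2}{\sqrt{\lambda_{\min}(A_{\mathcal{J}}^{\top}A_{\mathcal{J}})}},$$ where $\lambda_{\max}(A_{\mathcal{J}}^{\top}A_{\mathcal{J}})$ and $\lambda_{\min}(A_{\mathcal{J}}^{\top}A_{\mathcal{J}})$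 are the largest and smallest eigenvalues of $A_{\mathcal{J}}^{\top}A_{\mathcal{J}}$, respectively. Moreover, when $\sigma=0$, we have $\bm{x}^*_{\mathcal{J}}=(A_{\mathcal{J}}^{\top}A_{\mathcal{J}})^{-1}A_{\mathcal{J}}^{\top}\bm{b}$.
   Context: For $\bm{x}\in\mathbb{R}^n$ and $0<p\le 1$, $\|\bm{x}\|_p^p:=\sum_{i=1}^n|x_i|^p$; for $p=0$, $\|\bm{x}\|_p^p$ means $\|\bm{x}\|_0$, the number of nonzero entries of $\bm{x}$. For $1\le q\le\infty$, $\|\cdot\|_q$ is the usual $\ell_q$-norm. ${\rm SOL}(A,\bm{b},\sigma,p,q)$ denotes the set of (global) optimal solutions of $$\min_{\bm{x}\in\mathbb{R}^n}\ \|\bm{x}\|_p^p\quad\text{s.t.}\quad\|A\bm{x}-\bm{b}\|_q\le\sigma .$$ $\mathrm{supp}(\bm{x})=\{i:x_i\ne0\}$; $|\mathcal{J}|$ is the cardinality of an index set $\mathcal{J}$; $A_{\mathcal{J}}$ is the submatrix of $A$ formed by the columns indexed by $\mathcal{J}$, and $\bm{x}_{\mathcal{J}}$ is the subvector of $\bm{x}$ formed by the entries indexed by $\mathcal{J}$. Convention: $\frac1\infty=0$. *)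

theory Defs
  imports
    "HOL-Library.Extended_Real"
    "Jordan_Normal_Form.Spectral_Radius"
    "Jordan_Normal_Form.Gauss_Jordan_Elimination"
    "Jordan_Normal_Form.DL_Rank"
    "Jordan_Normal_Form.DL_Submatrix"
begin

definition vec_supp :: "real vec \<Rightarrow> nat set" where
  "vec_supp x = {i. i < dim_vec x \<and> x $ i \<noteq> 0}"

definition zero_norm :: "real vec \<Rightarrow> nat" where
  "zero_norm x = card (vec_supp x)"

(* The p-th power of the l_p quasi-norm, with the convention that it counts nonzero entries
   at p = 0. *)
definition lp_pow :: "real \<Rightarrow> real vec \<Rightarrow> real" where
  "lp_pow p x = (if p = 0 then real (zero_norm x) else (\<Sum>i<dim_vec x. \<bar>x $ i\<bar> powr p))"

(* The l_q norm, meant for 1 <= q <= infinity. The inserted 0 only matters in dimension 0,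
   where it makes the maximum well defined. *)
definition lq_norm :: "ereal \<Rightarrow> real vec \<Rightarrow> real" where
  "lq_norm q v =
     (if q = \<infinity> then Max (insert 0 ((\<lambda>i. \<bar>v $ i\<bar>) ` {..<dim_vec v}))
      else (\<Sum>i<dim_vec v. \<bar>v $ i\<bar> powr real_of_ereal q) powr (1 / real_of_ereal q))"

definition feasible :: "real mat \<Rightarrow> real vec \<Rightarrow> real \<Rightarrow> ereal \<Rightarrow> real vec set" where
  "feasible A b \<sigma> q = {x \<in> carrier_vec (dim_col A). lq_norm q (A *\<^sub>v x - b) \<le> \<sigma>}"

definition SOL :: "real mat \<Rightarrow> real vec \<Rightarrow> real \<Rightarrow> real \<Rightarrow> ereal \<Rightarrow> real vec set" where
  "SOL A b \<sigma> p q =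
     {x \<in> feasible A b \<sigma> q. \<forall>y \<in> feasible A b \<sigma> q. lp_pow p x \<le> lp_pow p y}"

(* Entries indexed by J in increasing order, the same enumeration that submatrix uses. *)
definition subvec :: "real vec \<Rightarrow> nat set \<Rightarrow> real vec" where
  "subvec x J = vec (card {i. i < dim_vec x \<and> i \<in> J}) (\<lambda>i. x $ pick J i)"

(* Largest and smallest real eigenvalue; meant for symmetric matrices of positive dimension,
   all of whose eigenvalues are real. *)
definition lambda_max :: "real mat \<Rightarrow> real" where
  "lambda_max M = Max (spectrum M)"

definition lambda_min :: "real mat \<Rightarrow> real" where
  "lambda_min M = Min (spectrum M)"

end

theory Submission
  imports Defs "HOL-Analysis.Convex" "HOL-Analysis.Elementary_Metric_Spaces"
begin

text \<open>The residual is a convex function of the scaling factor along the segment from \<open>0\<close> to a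
  solution \<open>x\<close>; it exceeds \<open>\<sigma>\<close> at \<open>0\<close> and is at most \<open>\<sigma>\<close> at \<open>x\<close>, so it takes the value \<open>\<sigma>\<close> at some
  factor \<open>\<alpha>\<close>, beyond which feasibility persists. For \<open>p > 0\<close> shrinking \<open>x\<close> lowers the objective,
  hence \<open>\<alpha> = 1\<close>. If the columns of \<open>A\<close> on the support were dependent, one could move from \<open>x\<close> in
  both directions of a kernel vector until an entry vanishes; as \<open>p < 1\<close>, one of the two end points
  has a smaller objective. The bounds follow from the Rayleigh bounds for the Gram matrix of the
  support columns and the comparison of \<open>\<ell>\<^sub>q\<close> with \<open>\<ell>\<^sub>2\<close>.\<close>

unbundle no inner_syntax

section \<open>Convexity of powers and the \<open>\<ell>\<^sub>q\<close> norms\<close>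

text \<open>For positive arguments this is \<open>powr_convex\<close>; the endpoint 0 is added
  because entries of a vector may vanish. When \<open>u\<close> or \<open>v\<close> is 0, the claim
  reduces to \<open>s powr q \<le> s\<close> for \<open>0 < s \<le> 1\<close>.\<close>

lemma convex_on_powr:
  fixes q :: real
  assumes q: "1 \<le> q"
  shows "convex_on {0..} (\<lambda>x. x powr q)"
proof (rule convex_onI)
  fix t u v :: real
  assume t: "0 < t" "t < 1" and "u \<in> {0..}" "v \<in> {0..}"
  have scale: "(s * w) powr q \<le> s * w powr q" if "0 \<le> s" "s \<le> 1" "0 \<le> w" for s w :: real
  proof (cases "s = 0")
    case False
    have "s powr q \<le> s powr 1"
      using that False q by (intro powr_mono') auto
    then show ?thesis
      using that False by (simp add: powr_mult mult_right_mono)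
  qed simp
  show "((1 - t) *\<^sub>R u + t *\<^sub>R v) powr q \<le> (1 - t) * u powr q + t * v powr q"
  proof (cases "u = 0 \<or> v = 0")
    case True
    then show ?thesis
      using scale[of t v] scale[of "1 - t" u] t \<open>u \<in> {0..}\<close> \<open>v \<in> {0..}\<close> by auto
  next
    case False
    then show ?thesis
      using convex_onD[OF powr_convex[OF q], of t u v] t \<open>u \<in> {0..}\<close> \<open>v \<in> {0..}\<close> by auto
  qed
qed auto

text \<open>Concavity of the power \<open>p\<close> is read off from convexity of its inverse, the
  power \<open>1 / p\<close>, at the midpoint of \<open>u\<close> and \<open>v\<close>. The
  degenerate cases use \<open>0 powr p = 0\<close>, which holds even at
  \<open>p = 0\<close>.\<close>

lemma powr_midpoint_concave:
  fixes a d p :: real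
  assumes p: "0 \<le> p" "p \<le> 1" and d: "\<bar>d\<bar> \<le> a"
  shows "(a + d) powr p + (a - d) powr p \<le> 2 * a powr p"
proof (cases "p = 0 \<or> a = 0")
  case True
  then show ?thesis using d by auto
next
  case False
  then have p0: "p > 0" and a0: "a > 0" using p d by auto
  define u where "u = (a + d) powr p"
  define v where "v = (a - d) powr p"
  have uv: "u \<ge> 0" "v \<ge> 0" by (simp_all add: u_def v_def)
  have r: "1 \<le> 1 / p" using p p0 by simp
  have "((1 - 1/2) *\<^sub>R u + (1/2) *\<^sub>R v) powr (1/p)
      \<le> (1 - 1/2) * u powr (1/p) + (1/2) * v powr (1/p)"
    using convex_onD[OF convex_on_powr[OF r], of "1/2" u v] uv by simp
  also have "\<dots> = a"
    using d p0 by (simp add: u_def v_def powr_powr field_simps)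
  finally have "((u + v) / 2) powr (1/p) \<le> a"
    by (simp add: field_simps)
  then have "(((u + v) / 2) powr (1/p)) powr p \<le> a powr p"
    using p0 by (intro powr_mono2) auto
  then show ?thesis
    using uv p0 by (simp add: powr_powr u_def v_def)
qed

section \<open>Norm properties of \<open>lq_norm\<close>\<close>

lemma lq_norm_infinity_le_iff:
  "lq_norm \<infinity> v \<le> c \<longleftrightarrow> 0 \<le> c \<and> (\<forall>i<dim_vec v. \<bar>v $ i\<bar> \<le> c)"
  by (auto simp: lq_norm_def)

lemma lq_norm_ereal:
  "lq_norm (ereal r) v = (\<Sum>i<dim_vec v. \<bar>v $ i\<bar> powr r) powr (1 / r)"
  by (simp add: lq_norm_def)

lemma lq_norm_nonneg: "0 \<le> lq_norm q v"
  by (auto simp: lq_norm_def Max_ge_iff)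

lemma one_le_ereal_cases:
  fixes q :: ereal
  assumes "1 \<le> q"
  obtains "q = \<infinity>" | r where "q = ereal r" "1 \<le> r"
  using assms by (cases q) (auto simp: one_ereal_def)

lemma lq_norm_powr:
  assumes "0 < r"
  shows "lq_norm (ereal r) v powr r = (\<Sum>i<dim_vec v. \<bar>v $ i\<bar> powr r)"
  using assms by (simp add: lq_norm_ereal powr_powr sum_nonneg)

lemma abs_index_le_lq_norm:
  assumes q: "1 \<le> q" and i: "i < dim_vec v"
  shows "\<bar>v $ i\<bar> \<le> lq_norm q v"
  using q
proof (cases rule: one_le_ereal_cases)
  case 1
  then show ?thesis using i lq_norm_infinity_le_iff[of v "lq_norm \<infinity> v"] by auto
next
  case (2 r)
  have "(\<bar>v $ i\<bar> powr r) powr (1/r) \<le> (\<Sum>i<dim_vec v. \<bar>v $ i\<bar> powr r) powr (1/r)"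
    using 2 i by (intro powr_mono2 member_le_sum[of i]) auto
  then show ?thesis using 2 by (simp add: lq_norm_ereal powr_powr)
qed

lemma lq_norm_eq_0D:
  assumes "1 \<le> q" "lq_norm q v = 0"
  shows "v = 0\<^sub>v (dim_vec v)"
  using abs_index_le_lq_norm[OF assms(1), of _ v] assms(2) by (intro eq_vecI) auto

lemma lq_norm_zero: "lq_norm q (0\<^sub>v n) = 0"
  by (cases "n = 0") (auto simp: lq_norm_def image_constant_conv)

lemma lq_norm_leI:
  assumes "0 < r" "0 \<le> c" "(\<Sum>i<dim_vec v. \<bar>v $ i\<bar> powr r) \<le> c powr r"
  shows "lq_norm (ereal r) v \<le> c"
proof -
  have "(\<Sum>i<dim_vec v. \<bar>v $ i\<bar> powr r) powr (1/r) \<le> (c powr r) powr (1/r)"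
    using assms by (intro powr_mono2) (auto intro: sum_nonneg)
  then show ?thesis using assms by (simp add: lq_norm_ereal powr_powr)
qed

lemma lq_norm_smult_le:
  assumes q: "1 \<le> q"
  shows "lq_norm q (c \<cdot>\<^sub>v v) \<le> \<bar>c\<bar> * lq_norm q v"
  using q
proof (cases rule: one_le_ereal_cases)
  case 1
  then show ?thesis using abs_index_le_lq_norm[OF q, of _ v]
    by (auto simp: lq_norm_infinity_le_iff abs_mult lq_norm_nonneg intro!: mult_left_mono)
next
  case (2 r)
  have "(\<Sum>i<dim_vec (c \<cdot>\<^sub>v v). \<bar>(c \<cdot>\<^sub>v v) $ i\<bar> powr r) = \<bar>c\<bar> powr r * (\<Sum>i<dim_vec v. \<bar>v $ i\<bar> powr r)"
    by (simp add: sum_distrib_left abs_mult powr_mult)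
  also have "\<dots> = (\<bar>c\<bar> * lq_norm q v) powr r"
    using 2 by (simp add: powr_mult lq_norm_powr lq_norm_nonneg)
  finally show ?thesis
    using 2 by (simp add: lq_norm_leI lq_norm_nonneg)
qed

text \<open>Minkowski's inequality: once \<open>u\<close> and \<open>v\<close> are scaled to norm 1,
  each entry of the scaled sum is dominated by a convex combination, and convexity of the power
  \<open>r\<close> is summed over the entries.\<close>

lemma lq_norm_triangle:
  assumes q: "1 \<le> q" and dim: "dim_vec u = dim_vec v"
  shows "lq_norm q (u + v) \<le> lq_norm q u + lq_norm q v"
  using q
proof (cases rule: one_le_ereal_cases)
  case 1
  have "\<bar>u $ i + v $ i\<bar> \<le> lq_norm q u + lq_norm q v" if "i < dim_vec v" for i
    using abs_index_le_lq_norm[OF q, of i u] abs_index_le_lq_norm[OF q, of i v] that dim by auto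
  then show ?thesis using 1 dim by (auto simp: lq_norm_infinity_le_iff lq_norm_nonneg)
next
  case (2 r)
  define a where "a = lq_norm q u"
  define c where "c = lq_norm q v"
  have nonneg: "0 \<le> a" "0 \<le> c" by (simp_all add: a_def c_def lq_norm_nonneg)
  show ?thesis
  \<comment> \<open>The scaling divides by both norms; a vanishing norm means a zero vector, which
    is harmless.\<close>
  proof (cases "a = 0 \<or> c = 0")
    case True
    then have "u + v = v \<and> a = 0 \<or> u + v = u \<and> c = 0"
      using lq_norm_eq_0D[OF q, of u] lq_norm_eq_0D[OF q, of v] dim
      by (metis a_def c_def carrier_vec_dim_vec left_zero_vec right_zero_vec)
    then show ?thesis using nonneg by (auto simp: a_def c_def)
  next
    case False
    then have pos: "a > 0" "c > 0" using nonneg by auto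
    \<comment> \<open>With this weight \<open>(a + c) * (1 - t) = a\<close> and
      \<open>(a + c) * t = c\<close>, which undoes the scaling.\<close>
    define t where "t = c / (a + c)"
    have t: "0 \<le> t" "t \<le> 1" and t': "1 - t = a / (a + c)"
      using pos by (auto simp: t_def field_simps)
    have sum_u: "(\<Sum>i<dim_vec v. (\<bar>u $ i\<bar> / a) powr r) = 1"
      using lq_norm_powr[of r u, symmetric] 2 pos dim
      by (simp add: powr_divide sum_divide_distrib[symmetric] a_def)
    have sum_v: "(\<Sum>i<dim_vec v. (\<bar>v $ i\<bar> / c) powr r) = 1"
      using lq_norm_powr[of r v, symmetric] 2 pos
      by (simp add: powr_divide sum_divide_distrib[symmetric] c_def)
    have "\<bar>(u + v) $ i\<bar> powr r
        \<le> (a + c) powr r * ((1 - t) * (\<bar>u $ i\<bar> / a) powr r + t * (\<bar>v $ i\<bar> / c) powr r)"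
      if "i < dim_vec v" for i
    proof -
      have "(a + c) * ((1 - t) * (\<bar>u $ i\<bar> / a) + t * (\<bar>v $ i\<bar> / c))
          = ((a + c) * (1 - t)) * (\<bar>u $ i\<bar> / a) + ((a + c) * t) * (\<bar>v $ i\<bar> / c)"
        by (simp only: distrib_left mult.assoc)
      also have "\<dots> = \<bar>u $ i\<bar> + \<bar>v $ i\<bar>"
        using pos unfolding t' unfolding t_def by simp
      finally have "\<bar>(u + v) $ i\<bar> \<le> (a + c) * ((1 - t) * (\<bar>u $ i\<bar> / a) + t * (\<bar>v $ i\<bar> / c))"
        using that by simp
      then have "\<bar>(u + v) $ i\<bar> powr r
          \<le> ((a + c) * ((1 - t) * (\<bar>u $ i\<bar> / a) + t * (\<bar>v $ i\<bar> / c))) powr r"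
        using 2 by (intro powr_mono2) auto
      also have "\<dots> = (a + c) powr r * ((1 - t) * (\<bar>u $ i\<bar> / a) + t * (\<bar>v $ i\<bar> / c)) powr r"
        by (rule powr_mult)
      also have "\<dots> \<le> (a + c) powr r * ((1 - t) * (\<bar>u $ i\<bar> / a) powr r + t * (\<bar>v $ i\<bar> / c) powr r)"
        using convex_onD[OF convex_on_powr[OF 2(2)], of t "\<bar>u $ i\<bar> / a" "\<bar>v $ i\<bar> / c"] t pos
        by (intro mult_left_mono) auto
      finally show ?thesis .
    qed
    then have "(\<Sum>i<dim_vec v. \<bar>(u + v) $ i\<bar> powr r)
        \<le> (\<Sum>i<dim_vec v. (a + c) powr r * ((1 - t) * (\<bar>u $ i\<bar> / a) powr r + t * (\<bar>v $ i\<bar> / c) powr r))"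
      by (intro sum_mono) auto
    also have "\<dots> = (a + c) powr r"
      by (simp add: sum_distrib_left[symmetric] sum.distrib sum_u sum_v)
    finally show ?thesis
      using 2 nonneg by (simp add: lq_norm_leI a_def c_def)
  qed
qed

text \<open>The reverse inequality is the upper bound for the factor \<open>1 / c\<close> applied to
  the scaled vector.\<close>

lemma lq_norm_smult:
  assumes q: "1 \<le> q"
  shows "lq_norm q (c \<cdot>\<^sub>v v) = \<bar>c\<bar> * lq_norm q v"
proof (cases "c = 0")
  case True
  have "0 \<cdot>\<^sub>v v = 0\<^sub>v (dim_vec v)" by (intro eq_vecI) auto
  then show ?thesis using True by (simp add: lq_norm_zero)
next
  case False
  have "v = (1 / c) \<cdot>\<^sub>v (c \<cdot>\<^sub>v v)"
    using False by (simp add: smult_smult_assoc)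
  then have "lq_norm q v \<le> \<bar>1 / c\<bar> * lq_norm q (c \<cdot>\<^sub>v v)"
    using lq_norm_smult_le[OF q] by metis
  then show ?thesis
    using lq_norm_smult_le[OF q, of c v] False by (simp add: field_simps)
qed

section \<open>Comparison of the norms for different exponents\<close>

lemma lq_norm_antimono:
  assumes "1 \<le> q" "q \<le> s"
  shows "lq_norm s v \<le> lq_norm q v"
proof -
  have s: "1 \<le> s" using assms by (rule order_trans)
  from s show ?thesis
  proof (cases rule: one_le_ereal_cases)
    case 1
    then show ?thesis
      using abs_index_le_lq_norm[OF assms(1)] by (auto simp: lq_norm_infinity_le_iff lq_norm_nonneg)
  next
    case (2 s')
    then obtain r where r: "q = ereal r" "1 \<le> r" "r \<le> s'"
      using assms by (cases q) (auto simp: one_ereal_def)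
    define c where "c = lq_norm q v"
    have c: "0 \<le> c" by (simp add: c_def lq_norm_nonneg)
    \<comment> \<open>Every entry is at most \<open>c\<close>, so the split-off power
      \<open>s' - r\<close> is bounded and the sum of the powers \<open>r\<close> is left.\<close>
    have "(\<Sum>i<dim_vec v. \<bar>v $ i\<bar> powr s') = (\<Sum>i<dim_vec v. \<bar>v $ i\<bar> powr (s' - r) * \<bar>v $ i\<bar> powr r)"
      by (simp add: powr_add[symmetric])
    also have "\<dots> \<le> (\<Sum>i<dim_vec v. c powr (s' - r) * \<bar>v $ i\<bar> powr r)"
      using abs_index_le_lq_norm[OF assms(1)] r
      by (intro sum_mono mult_right_mono powr_mono2) (auto simp: c_def)
    also have "\<dots> = c powr (s' - r) * c powr r"
      using r by (simp add: sum_distrib_left[symmetric] lq_norm_powr c_def)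
    also have "\<dots> = c powr s'"
      by (simp add: powr_add[symmetric])
    finally show ?thesis
      using 2 c by (simp add: lq_norm_leI c_def)
  qed
qed

text \<open>Jensen's inequality for the convex power \<open>s' / r\<close>, with equal weights. For
  \<open>s = \<infinity>\<close> each entry is bounded by the maximum instead.\<close>

lemma lq_norm_power_mean:
  assumes "1 \<le> q" "q \<le> s" "0 < dim_vec v"
  shows "lq_norm q v \<le> real (dim_vec v) powr (real_of_ereal (1 / q) - real_of_ereal (1 / s)) * lq_norm s v"
proof -
  let ?m = "real (dim_vec v)"
  have s: "1 \<le> s" using assms by (meson order_trans)
  show ?thesis
  proof (cases "q = \<infinity>")
    case True
    \<comment> \<open>Here \<open>s = \<infinity>\<close> as well; the exponent is 0, and the factor
      is 1 because the dimension is positive.\<close>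
    then show ?thesis using assms by auto
  next
    case False
    then obtain r where r: "q = ereal r" "1 \<le> r"
      using assms(1) by (auto elim: one_le_ereal_cases)
    from s show ?thesis
    proof (cases rule: one_le_ereal_cases)
      case 1
      have "(\<Sum>i<dim_vec v. \<bar>v $ i\<bar> powr r) \<le> (\<Sum>i<dim_vec v. lq_norm s v powr r)"
        using abs_index_le_lq_norm[OF s, of _ v] r by (intro sum_mono powr_mono2) auto
      also have "\<dots> = (?m powr (1 / r) * lq_norm s v) powr r"
        using r assms(3) by (simp add: powr_mult powr_powr lq_norm_nonneg)
      finally have "lq_norm (ereal r) v \<le> ?m powr (1 / r) * lq_norm s v"
        using r by (intro lq_norm_leI) (auto simp: lq_norm_nonneg)
      then show ?thesis using r 1 by (simp add: one_ereal_def)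
    next
      case (2 s')
      have rs: "r \<le> s'" using assms(2) 2 r by simp
      let ?S = "\<Sum>i<dim_vec v. \<bar>v $ i\<bar> powr s'"
      let ?R = "\<Sum>i<dim_vec v. \<bar>v $ i\<bar> powr r"
      have "(\<Sum>i<dim_vec v. (1 / ?m) *\<^sub>R (\<bar>v $ i\<bar> powr r)) powr (s' / r)
          \<le> (\<Sum>i<dim_vec v. (1 / ?m) * (\<bar>v $ i\<bar> powr r) powr (s' / r))"
        using r rs assms(3) by (intro convex_on_sum[OF _ _ convex_on_powr]) auto
      then have le: "(?R / ?m) powr (s' / r) \<le> ?S / ?m"
        using r by (simp add: powr_powr sum_divide_distrib[symmetric])
      have "?R / ?m = ((?R / ?m) powr (s' / r)) powr (r / s')"
        using r rs by (simp add: powr_powr sum_nonneg)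
      also have "\<dots> \<le> (?S / ?m) powr (r / s')"
        using le r rs by (intro powr_mono2) auto
      also have "?S = lq_norm s v powr s'"
        using 2 r rs by (simp add: lq_norm_powr)
      also have "(lq_norm s v powr s' / ?m) powr (r / s') = lq_norm s v powr r / ?m powr (r / s')"
        using r rs by (simp add: powr_divide powr_powr)
      finally have "?R \<le> ?m * (lq_norm s v powr r / ?m powr (r / s'))"
        using assms(3) by (simp add: field_simps)
      also have "\<dots> = ?m powr (1 - r / s') * lq_norm s v powr r"
        using assms(3) by (simp add: powr_diff)
      also have "\<dots> = (?m powr (1 / r - 1 / s') * lq_norm s v) powr r"
        using r rs by (simp add: powr_mult powr_powr lq_norm_nonneg algebra_simps)
      finally have "lq_norm (ereal r) v \<le> ?m powr (1 / r - 1 / s') * lq_norm s v"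
        using r by (intro lq_norm_leI) (auto simp: lq_norm_nonneg)
      then show ?thesis using r rs 2 by (simp add: one_ereal_def)
    qed
  qed
qed

lemma lq_norm_2: "lq_norm 2 v = sqrt (v \<bullet> v)"
proof -
  have "lq_norm (ereal 2) v = sqrt (v \<bullet> v)"
    by (simp add: lq_norm_ereal scalar_prod_def powr_half_sqrt sum_nonneg atLeast0LessThan power2_eq_square
        flip: powr_realpow')
  then show ?thesis by simp
qed

lemma real_of_ereal_one_half: "real_of_ereal (1 / 2) = 1 / 2"
proof -
  have "(1::ereal) / 2 = ereal 1 / ereal 2" by (simp only: one_ereal_def numeral_eq_ereal)
  then show ?thesis by simp
qed

lemma real_of_ereal_inverse_le_half_iff:
  assumes "1 \<le> q"
  shows "real_of_ereal (1 / q) \<le> 1 / 2 \<longleftrightarrow> 2 \<le> q"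
  using assms
proof (cases rule: one_le_ereal_cases)
  case (2 r)
  have "2 \<le> q \<longleftrightarrow> 2 \<le> r" using 2 by simp
  then show ?thesis using 2 by (simp add: one_ereal_def field_simps)
qed simp

text \<open>The exponent switches at \<open>q = 2\<close>: above, it is 0 and the norms decrease in
  \<open>q\<close>; below, it cancels the factor of the power mean inequality between
  \<open>q\<close> and 2.\<close>

lemma lq_norm_le_lq_norm_2:
  assumes "1 \<le> q" "0 < dim_vec v"
  shows "lq_norm q v * real (dim_vec v) powr min (1 / 2 - real_of_ereal (1 / q)) 0 \<le> lq_norm 2 v"
proof (cases "2 \<le> q")
  case True
  then have "min (1 / 2 - real_of_ereal (1 / q)) 0 = 0"
    using real_of_ereal_inverse_le_half_iff[OF assms(1)] by (intro min_absorb2) simp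
  then show ?thesis
    using lq_norm_antimono[of 2 q v] True assms(2) by auto
next
  case False
  then have "q \<le> 2" and min: "min (1 / 2 - real_of_ereal (1 / q)) 0 = 1 / 2 - real_of_ereal (1 / q)"
    using real_of_ereal_inverse_le_half_iff[OF assms(1)] by (simp, intro min_absorb1, simp)
  have "lq_norm q v * real (dim_vec v) powr (1 / 2 - real_of_ereal (1 / q))
      \<le> real (dim_vec v) powr (real_of_ereal (1 / q) - 1 / 2) * lq_norm 2 v
        * real (dim_vec v) powr (1 / 2 - real_of_ereal (1 / q))"
    using lq_norm_power_mean[OF assms(1) \<open>q \<le> 2\<close> assms(2)]
    unfolding real_of_ereal_one_half by (intro mult_right_mono) simp_all
  also have "\<dots> = lq_norm 2 v *
      real (dim_vec v) powr ((real_of_ereal (1 / q) - 1 / 2) + (1 / 2 - real_of_ereal (1 / q)))"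
    unfolding powr_add by (simp only: ac_simps)
  also have "\<dots> = lq_norm 2 v"
    using assms(2) by auto
  finally show ?thesis
    unfolding min .
qed

text \<open>The regimes trade places: the power mean inequality serves \<open>q \<ge> 2\<close>,
  monotonicity serves \<open>q < 2\<close>.\<close>

lemma lq_norm_2_le_lq_norm:
  assumes "1 \<le> q" "0 < dim_vec v"
  shows "lq_norm 2 v \<le> lq_norm q v * real (dim_vec v) powr max (1 / 2 - real_of_ereal (1 / q)) 0"
proof (cases "2 \<le> q")
  case True
  then have max: "max (1 / 2 - real_of_ereal (1 / q)) 0 = 1 / 2 - real_of_ereal (1 / q)"
    using real_of_ereal_inverse_le_half_iff[OF assms(1)] by (intro max_absorb1) simp
  have "(1::ereal) \<le> 2" by simp
  from lq_norm_power_mean[OF this True assms(2)] show ?thesis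
    unfolding max real_of_ereal_one_half by (simp only: mult.commute)
next
  case False
  then have "max (1 / 2 - real_of_ereal (1 / q)) 0 = 0"
    using real_of_ereal_inverse_le_half_iff[OF assms(1)] by (intro max_absorb2) simp
  then show ?thesis
    using lq_norm_antimono[of q 2 v] False assms by auto
qed

section \<open>Residuals along a segment\<close>

lemma lq_norm_diff_commute:
  assumes "1 \<le> q" "dim_vec u = dim_vec v"
  shows "lq_norm q (u - v) = lq_norm q (v - u)"
proof -
  have "u - v = (- 1) \<cdot>\<^sub>v (v - u)" using assms(2) by (intro eq_vecI) auto
  then show ?thesis using lq_norm_smult[OF assms(1), of "- 1" "v - u"] by simp
qed

lemma lq_norm_le_add_diff:
  assumes "1 \<le> q" "dim_vec u = dim_vec v"
  shows "lq_norm q u \<le> lq_norm q (u - v) + lq_norm q v"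
proof -
  have "u = (u - v) + v" using assms(2) by (intro eq_vecI) auto
  then show ?thesis using lq_norm_triangle[OF assms(1), of "u - v" v] assms(2) by simp
qed

text \<open>By the triangle inequality the function is Lipschitz with constant
  \<open>lq_norm q w\<close>.\<close>

lemma continuous_on_lq_norm_line:
  assumes q: "1 \<le> q" and dim: "dim_vec w = dim_vec b"
  shows "continuous_on S (\<lambda>a. lq_norm q (a \<cdot>\<^sub>v w - b))"
proof (rule continuous_onI)
  have le: "lq_norm q (a \<cdot>\<^sub>v w - b) \<le> lq_norm q (c \<cdot>\<^sub>v w - b) + \<bar>a - c\<bar> * lq_norm q w" for a c
  proof -
    have "(a \<cdot>\<^sub>v w - b) - (c \<cdot>\<^sub>v w - b) = (a - c) \<cdot>\<^sub>v w"
      using dim by (intro eq_vecI) (auto simp: algebra_simps)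
    then show ?thesis
      using lq_norm_le_add_diff[OF q, of "a \<cdot>\<^sub>v w - b" "c \<cdot>\<^sub>v w - b"] dim
      by (simp add: lq_norm_smult[OF q])
  qed
  fix c e :: real
  assume "0 < e"
  \<comment> \<open>The added 1 keeps the denominator positive when \<open>w\<close> is
    zero.\<close>
  define d where "d = e / (lq_norm q w + 1)"
  have d: "0 < d" "d * (lq_norm q w + 1) = e"
    using \<open>0 < e\<close> lq_norm_nonneg[of q w] by (simp_all add: d_def)
  have "dist (lq_norm q (a \<cdot>\<^sub>v w - b)) (lq_norm q (c \<cdot>\<^sub>v w - b)) \<le> e" if "dist a c < d" for a
  proof -
    have "\<bar>a - c\<bar> * lq_norm q w \<le> d * (lq_norm q w + 1)"
      using that d(1) lq_norm_nonneg[of q w] by (intro mult_mono) (auto simp: dist_real_def)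
    then show ?thesis
      using le[of a c] le[of c a] d(2) by (simp add: dist_real_def abs_le_iff abs_minus_commute)
  qed
  then show "\<exists>d>0. \<forall>a\<in>S. dist a c < d \<longrightarrow>
      dist (lq_norm q (a \<cdot>\<^sub>v w - b)) (lq_norm q (c \<cdot>\<^sub>v w - b)) \<le> e"
    using d(1) by blast
qed

lemma lq_norm_line_reaches_level:
  assumes q: "1 \<le> q" and dim: "dim_vec w = dim_vec b"
    and b: "\<sigma> < lq_norm q b" and w: "lq_norm q (w - b) \<le> \<sigma>"
  obtains \<alpha> where "0 < \<alpha>" "\<alpha> \<le> 1" "lq_norm q (\<alpha> \<cdot>\<^sub>v w - b) = \<sigma>"
    "\<And>\<alpha>'. \<alpha> \<le> \<alpha>' \<Longrightarrow> \<alpha>' \<le> 1 \<Longrightarrow> lq_norm q (\<alpha>' \<cdot>\<^sub>v w - b) \<le> \<sigma>"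
proof -
  have "0 \<cdot>\<^sub>v w - b = (- 1) \<cdot>\<^sub>v b" using dim by (intro eq_vecI) auto
  then have f0: "lq_norm q (0 \<cdot>\<^sub>v w - b) = lq_norm q b" by (simp add: lq_norm_smult[OF q])
  have f1: "lq_norm q (1 \<cdot>\<^sub>v w - b) = lq_norm q (w - b)" by simp
  obtain \<alpha> where \<alpha>: "0 \<le> \<alpha>" "\<alpha> \<le> 1" "lq_norm q (\<alpha> \<cdot>\<^sub>v w - b) = \<sigma>"
    using IVT2'[of "\<lambda>a. lq_norm q (a \<cdot>\<^sub>v w - b)" 1 \<sigma> 0] f0 f1 b w
      continuous_on_lq_norm_line[OF q dim] by auto
  have "\<alpha> \<noteq> 0" using \<alpha>(3) f0 b by auto
  moreover have "lq_norm q (\<alpha>' \<cdot>\<^sub>v w - b) \<le> \<sigma>" if \<alpha>': "\<alpha> \<le> \<alpha>'" "\<alpha>' \<le> 1" for \<alpha>'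
  proof (cases "\<alpha> = 1")
    case True
    then show ?thesis using \<alpha> \<alpha>' by auto
  next
    case False
    \<comment> \<open>The weight that writes \<open>\<alpha>'\<close> as a convex combination of
      \<open>\<alpha>\<close> and 1, where the residual is at most \<open>\<sigma>\<close>; its
      denominator is why \<open>\<alpha> = 1\<close> is split off.\<close>
    define s where "s = (1 - \<alpha>') / (1 - \<alpha>)"
    have s: "0 \<le> s" "s \<le> 1" using \<alpha> \<alpha>' False by (auto simp: s_def field_simps)
    have "s * (1 - \<alpha>) = 1 - \<alpha>'" using \<alpha> False by (simp add: s_def)
    then have comb: "\<alpha>' = s * \<alpha> + (1 - s)" by (simp add: algebra_simps)
    have "\<alpha>' \<cdot>\<^sub>v w - b = s \<cdot>\<^sub>v (\<alpha> \<cdot>\<^sub>v w - b) + (1 - s) \<cdot>\<^sub>v (w - b)"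
      using dim unfolding comb by (intro eq_vecI) (auto simp: algebra_simps)
    then have "lq_norm q (\<alpha>' \<cdot>\<^sub>v w - b) \<le> s * \<sigma> + (1 - s) * lq_norm q (w - b)"
      using lq_norm_triangle[OF q, of "s \<cdot>\<^sub>v (\<alpha> \<cdot>\<^sub>v w - b)" "(1 - s) \<cdot>\<^sub>v (w - b)"] dim s \<alpha>(3)
      by (simp add: lq_norm_smult[OF q])
    also have "\<dots> \<le> s * \<sigma> + (1 - s) * \<sigma>"
      using s w by (intro add_left_mono mult_left_mono) auto
    finally show ?thesis by (simp add: algebra_simps)
  qed
  ultimately show thesis using that \<alpha> by (metis order_le_less)
qed

section \<open>Extreme eigenvalues of symmetric matrices\<close>

lemma scalar_prod_self: "v \<bullet> v = (\<Sum>i<dim_vec v. (v $ i)\<^sup>2)" for v :: "real vec"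
  by (simp add: scalar_prod_def atLeast0LessThan power2_eq_square)

lemma scalar_prod_self_nonneg: "0 \<le> v \<bullet> v" for v :: "real vec"
  by (simp add: scalar_prod_self sum_nonneg)

lemma scalar_prod_self_eq_0_iff: "v \<bullet> v = 0 \<longleftrightarrow> v = 0\<^sub>v (dim_vec v)" for v :: "real vec"
proof -
  have "v = 0\<^sub>v (dim_vec v) \<longleftrightarrow> (\<forall>i<dim_vec v. v $ i = 0)" by (simp add: vec_eq_iff)
  then show ?thesis by (auto simp: scalar_prod_self sum_nonneg_eq_0_iff)
qed

lemma scalar_prod_self_pos:
  fixes v :: "real vec"
  assumes "v \<in> carrier_vec n" "v \<noteq> 0\<^sub>v n"
  shows "0 < v \<bullet> v"
  using scalar_prod_self_nonneg[of v] scalar_prod_self_eq_0_iff[of v] assms by auto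

lemma square_index_le_scalar_prod_self:
  fixes v :: "real vec"
  assumes "i < dim_vec v"
  shows "(v $ i)\<^sup>2 \<le> v \<bullet> v"
  unfolding scalar_prod_self using assms by (intro member_le_sum[of i]) auto

text \<open>Each product of two entries of \<open>y\<close> is at most \<open>y \<bullet> y\<close>
  in absolute value, so the sum of the absolute entries of \<open>M\<close> serves as constant;
  adding 1 makes it positive, ready for division.\<close>

lemma quadratic_form_bound:
  fixes M :: "real mat"
  assumes M: "M \<in> carrier_mat k k"
  obtains C where "0 < C" "\<And>y. y \<in> carrier_vec k \<Longrightarrow> \<bar>y \<bullet> (M *\<^sub>v y)\<bar> \<le> C * (y \<bullet> y)"
proof
  let ?S = "\<Sum>i<k. \<Sum>j<k. \<bar>M $$ (i, j)\<bar>"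
  show "0 < 1 + ?S" by (simp add: sum_nonneg add_pos_nonneg)
  fix y :: "real vec" assume y: "y \<in> carrier_vec k"
  have entry: "\<bar>y $ i * y $ j\<bar> \<le> y \<bullet> y" if "i < k" "j < k" for i j
  proof -
    have "0 \<le> (\<bar>y $ i\<bar> - \<bar>y $ j\<bar>)\<^sup>2" by simp
    then have "2 * \<bar>y $ i * y $ j\<bar> \<le> (y $ i)\<^sup>2 + (y $ j)\<^sup>2"
      by (simp add: power2_eq_square algebra_simps abs_mult)
    then show ?thesis
      using square_index_le_scalar_prod_self[of i y] square_index_le_scalar_prod_self[of j y] that y by simp
  qed
  have "y \<bullet> (M *\<^sub>v y) = (\<Sum>i<k. \<Sum>j<k. M $$ (i, j) * (y $ i * y $ j))"
    using M y by (simp add: scalar_prod_def atLeast0LessThan sum_distrib_left ac_simps)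
  also have "\<bar>\<dots>\<bar> \<le> (\<Sum>i<k. \<bar>\<Sum>j<k. M $$ (i, j) * (y $ i * y $ j)\<bar>)"
    by (rule sum_abs)
  also have "\<dots> \<le> (\<Sum>i<k. \<Sum>j<k. \<bar>M $$ (i, j) * (y $ i * y $ j)\<bar>)"
    by (intro sum_mono sum_abs)
  also have "\<dots> \<le> (\<Sum>i<k. \<Sum>j<k. \<bar>M $$ (i, j)\<bar> * (y \<bullet> y))"
    using entry by (intro sum_mono) (auto simp: abs_mult intro!: mult_left_mono)
  also have "\<dots> = ?S * (y \<bullet> y)"
    by (simp add: sum_distrib_right)
  also have "\<dots> \<le> (1 + ?S) * (y \<bullet> y)"
    by (intro mult_right_mono) (auto simp: scalar_prod_self_nonneg)
  finally show "\<bar>y \<bullet> (M *\<^sub>v y)\<bar> \<le> (1 + ?S) * (y \<bullet> y)" .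
qed

lemma scalar_prod_gram:
  fixes B :: "real mat"
  assumes B: "B \<in> carrier_mat m k" and y: "y \<in> carrier_vec k"
  shows "y \<bullet> ((B\<^sup>T * B) *\<^sub>v y) = (B *\<^sub>v y) \<bullet> (B *\<^sub>v y)"
proof -
  have "y \<bullet> ((B\<^sup>T * B) *\<^sub>v y) = y \<bullet> (B\<^sup>T *\<^sub>v (B *\<^sub>v y))"
    using B y by (simp add: assoc_mult_mat_vec[of "B\<^sup>T" k m B k y])
  also have "\<dots> = (B\<^sup>T *\<^sub>v (B *\<^sub>v y)) \<bullet> y"
    using B y by (intro comm_scalar_prod[of _ k]) auto
  also have "\<dots> = (B *\<^sub>v y) \<bullet> (B *\<^sub>v y)"
    using B y by (intro transpose_vec_mult_scalar[of _ m k]) auto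
  finally show ?thesis .
qed

text \<open>The squared length of \<open>B *\<^sub>v y\<close> is the quadratic form of the Gram
  matrix \<open>B\<^sup>T * B\<close>.\<close>

lemma mult_mat_vec_bound:
  fixes B :: "real mat"
  assumes B: "B \<in> carrier_mat k k"
  obtains C where "0 < C" "\<And>y. y \<in> carrier_vec k \<Longrightarrow> (B *\<^sub>v y) \<bullet> (B *\<^sub>v y) \<le> C * (y \<bullet> y)"
proof -
  have "B\<^sup>T * B \<in> carrier_mat k k" using B by simp
  then obtain C where "0 < C" "\<And>y. y \<in> carrier_vec k \<Longrightarrow> \<bar>y \<bullet> ((B\<^sup>T * B) *\<^sub>v y)\<bar> \<le> C * (y \<bullet> y)"
    using quadratic_form_bound by blast
  then show thesis
    using scalar_prod_gram[OF B] that by (metis abs_le_D1)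
qed

text \<open>With \<open>z = N *\<^sub>v y\<close>, positivity of the form yields
  \<open>z \<bullet> z \<le> C * (y \<bullet> z)\<close>, and boundedness of the inverse yields
  \<open>y \<bullet> y \<le> D * (z \<bullet> z)\<close>. Together they give the constant
  \<open>1 / (C * D)\<close>.\<close>

lemma psd_nonsingular_coercive:
  fixes N :: "real mat"
  assumes N: "N \<in> carrier_mat k k" and sym: "N\<^sup>T = N" and det: "det N \<noteq> 0"
    and psd: "\<And>y. y \<in> carrier_vec k \<Longrightarrow> 0 \<le> y \<bullet> (N *\<^sub>v y)"
  obtains c where "0 < c" "\<And>y. y \<in> carrier_vec k \<Longrightarrow> c * (y \<bullet> y) \<le> y \<bullet> (N *\<^sub>v y)"
proof -
  obtain N' where N': "N' \<in> carrier_mat k k" "N' * N = 1\<^sub>m k"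
    using det_non_zero_imp_unit[OF N det, of "()"] by (auto simp: Units_def ring_mat_def)
  obtain C where C: "0 < C" "\<And>y. y \<in> carrier_vec k \<Longrightarrow> \<bar>y \<bullet> (N *\<^sub>v y)\<bar> \<le> C * (y \<bullet> y)"
    using quadratic_form_bound[OF N] by blast
  obtain D where D: "0 < D" "\<And>y. y \<in> carrier_vec k \<Longrightarrow> (N' *\<^sub>v y) \<bullet> (N' *\<^sub>v y) \<le> D * (y \<bullet> y)"
    using mult_mat_vec_bound[OF N'(1)] by blast
  have "1 / (C * D) * (y \<bullet> y) \<le> y \<bullet> (N *\<^sub>v y)" if y: "y \<in> carrier_vec k" for y
  proof -
    define z where "z = N *\<^sub>v y"
    have z: "z \<in> carrier_vec k" using N y by (simp add: z_def)
    have "N' *\<^sub>v z = y"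
      using N N' y by (simp add: z_def assoc_mult_mat_vec[of N' k k N k y, symmetric])
    then have yz: "y \<bullet> y \<le> D * (z \<bullet> z)"
      using D(2)[OF z] by simp
    \<comment> \<open>Nonnegativity of the form at \<open>y - z / C\<close>, i.e. Cauchy--Schwarz for the form.\<close>
    have Nz: "N *\<^sub>v z \<in> carrier_vec k" using N z by simp
    \<comment> \<open>Symmetry moves \<open>N\<close> from \<open>z\<close> to
      \<open>y\<close>.\<close>
    have zz: "y \<bullet> (N *\<^sub>v z) = z \<bullet> z"
      using transpose_vec_mult_scalar[OF N z y] by (simp add: z_def sym)
    have "N *\<^sub>v (y - (1 / C) \<cdot>\<^sub>v z) = z - (1 / C) \<cdot>\<^sub>v (N *\<^sub>v z)"
      using N y z by (simp add: mult_minus_distrib_mat_vec[of N k k] mult_mat_vec[of N k k] z_def)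
    then have "0 \<le> (y - (1 / C) \<cdot>\<^sub>v z) \<bullet> (z - (1 / C) \<cdot>\<^sub>v (N *\<^sub>v z))"
      using psd[of "y - (1 / C) \<cdot>\<^sub>v z"] y z by simp
    also have "\<dots> = y \<bullet> z - 2 * (1 / C) * (z \<bullet> z) + (1 / C)\<^sup>2 * (z \<bullet> (N *\<^sub>v z))"
      using y z Nz zz
      by (simp add: minus_scalar_prod_distrib[of _ k] scalar_prod_minus_distrib[of _ k] algebra_simps power2_eq_square)
    also have "\<dots> \<le> y \<bullet> z - 2 * (1 / C) * (z \<bullet> z) + (1 / C)\<^sup>2 * (C * (z \<bullet> z))"
      using C(2)[OF z] by (intro add_left_mono mult_left_mono) auto
    also have "\<dots> = y \<bullet> z - (1 / C) * (z \<bullet> z)"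
      using C(1) by (simp add: power2_eq_square field_simps)
    finally have "z \<bullet> z \<le> C * (y \<bullet> z)"
      using C(1) by (simp add: field_simps)
    then have "D * (z \<bullet> z) \<le> D * (C * (y \<bullet> z))"
      using D(1) by (intro mult_left_mono) auto
    then have "y \<bullet> y \<le> D * (C * (y \<bullet> z))" using yz by linarith
    then show ?thesis
      using C(1) D(1) by (simp add: z_def field_simps)
  qed
  then show thesis using C(1) D(1) by (intro that[of "1 / (C * D)"]) auto
qed

text \<open>The bound is tested at an eigenvector. Thus lower bounds of the Rayleigh quotient are
  lower bounds of the spectrum.\<close>

lemma eigenvalue_ge_form_bound:
  fixes M :: "real mat"
  assumes M: "M \<in> carrier_mat k k" and ev: "eigenvalue M e"
    and bound: "\<And>y. y \<in> carrier_vec k \<Longrightarrow> c * (y \<bullet> y) \<le> y \<bullet> (M *\<^sub>v y)"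
  shows "c \<le> e"
proof -
  obtain v where v: "v \<in> carrier_vec k" "v \<noteq> 0\<^sub>v k" "M *\<^sub>v v = e \<cdot>\<^sub>v v"
    using ev M by (auto simp: eigenvalue_def eigenvector_def)
  then have "c * (v \<bullet> v) \<le> e * (v \<bullet> v)"
    using bound[of v] by simp
  then show ?thesis using scalar_prod_self_pos[OF v(1,2)] by simp
qed

text \<open>The supremum \<open>e\<close> of all lower bounds of the Rayleigh quotient is an eigenvalue without any
  compactness argument: otherwise \<open>M - e I\<close> would be positive semidefinite and nonsingular, hence
  coercive, and \<open>e\<close> could be increased.\<close>

lemma symmetric_least_eigenvalue:
  fixes M :: "real mat"
  assumes M: "M \<in> carrier_mat k k" and sym: "M\<^sup>T = M" and k: "0 < k"
  obtains e where "eigenvalue M e" "\<And>y. y \<in> carrier_vec k \<Longrightarrow> e * (y \<bullet> y) \<le> y \<bullet> (M *\<^sub>v y)"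
proof -
  define S where "S = {c. \<forall>y \<in> carrier_vec k. c * (y \<bullet> y) \<le> y \<bullet> (M *\<^sub>v y)}"
  obtain C where C: "\<And>y. y \<in> carrier_vec k \<Longrightarrow> \<bar>y \<bullet> (M *\<^sub>v y)\<bar> \<le> C * (y \<bullet> y)"
    using quadratic_form_bound[OF M] by blast
  have "- C \<in> S" unfolding S_def using C by (auto simp: abs_le_iff minus_le_iff)
  then have ne: "S \<noteq> {}" by auto
  have upper: "c \<le> (y \<bullet> (M *\<^sub>v y)) / (y \<bullet> y)" if "c \<in> S" "y \<in> carrier_vec k" "y \<noteq> 0\<^sub>v k" for c y
    using that scalar_prod_self_pos[of y k] by (simp add: S_def pos_le_divide_eq)
  \<comment> \<open>Positive dimension supplies a nonzero test vector, whose Rayleigh quotient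
    bounds \<open>S\<close> from above.\<close>
  have "unit_vec k 0 \<noteq> (0\<^sub>v k :: real vec)" using k by (simp add: unit_vec_nonzero)
  then have bdd: "bdd_above S"
    using upper[of _ "unit_vec k 0"] by (intro bdd_aboveI) auto
  define e where "e = Sup S"
  have e: "e * (y \<bullet> y) \<le> y \<bullet> (M *\<^sub>v y)" if y: "y \<in> carrier_vec k" for y
  proof (cases "y = 0\<^sub>v k")
    case True
    then show ?thesis using M by simp
  next
    case False
    then have "e \<le> (y \<bullet> (M *\<^sub>v y)) / (y \<bullet> y)"
      unfolding e_def using ne upper y by (intro cSup_least) auto
    then show ?thesis using scalar_prod_self_pos[OF y False] by (simp add: pos_le_divide_eq)
  qed
  define N where "N = M - e \<cdot>\<^sub>m 1\<^sub>m k"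
  have N: "N \<in> carrier_mat k k" unfolding N_def by (intro minus_carrier_mat) simp
  have Nsym: "N\<^sup>T = N"
  proof (rule eq_matI)
    fix i j assume "i < dim_row N" "j < dim_col N"
    then show "N\<^sup>T $$ (i, j) = N $$ (i, j)"
      using M N sym index_transpose_mat(1)[of j M i] by (auto simp: N_def)
  qed (use N in auto)
  have Nv: "N *\<^sub>v y = M *\<^sub>v y - e \<cdot>\<^sub>v y" if "y \<in> carrier_vec k" for y
  proof -
    have "(e \<cdot>\<^sub>m 1\<^sub>m k) *\<^sub>v y = e \<cdot>\<^sub>v y"
      using that by (intro eq_vecI) auto
    then show ?thesis
      using M that by (simp add: N_def minus_mult_distrib_mat_vec[of M k k])
  qed
  have form: "y \<bullet> (N *\<^sub>v y) = y \<bullet> (M *\<^sub>v y) - e * (y \<bullet> y)" if "y \<in> carrier_vec k" for y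
    using M that by (simp add: Nv scalar_prod_minus_distrib[of _ k])
  have "det N = 0"
  proof (rule ccontr)
    assume "det N \<noteq> 0"
    then obtain c where c: "0 < c" "\<And>y. y \<in> carrier_vec k \<Longrightarrow> c * (y \<bullet> y) \<le> y \<bullet> (N *\<^sub>v y)"
      using psd_nonsingular_coercive[OF N Nsym] form e by (metis diff_ge_0_iff_ge)
    then have "e + c \<in> S" by (auto simp: S_def form algebra_simps)
    then have "e + c \<le> e" unfolding e_def using bdd by (rule cSup_upper)
    then show False using c(1) by simp
  qed
  then obtain v where v: "v \<in> carrier_vec k" "v \<noteq> 0\<^sub>v k" "N *\<^sub>v v = 0\<^sub>v k"
    using det_0_iff_vec_prod_zero_field[OF N] by auto
  have "M *\<^sub>v v = e \<cdot>\<^sub>v v"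
  proof (rule eq_vecI)
    fix i assume "i < dim_vec (e \<cdot>\<^sub>v v)"
    then have "(M *\<^sub>v v - e \<cdot>\<^sub>v v) $ i = 0" using v M Nv[OF v(1)] by simp
    then show "(M *\<^sub>v v) $ i = (e \<cdot>\<^sub>v v) $ i"
      using v M \<open>i < dim_vec (e \<cdot>\<^sub>v v)\<close> by simp
  qed (use v M in simp)
  then have "eigenvalue M e"
    using v M by (auto simp: eigenvalue_def eigenvector_def)
  then show thesis using e that by blast
qed

text \<open>An eigenvalue that bounds the form from below also bounds all eigenvalues from below, so
  it is the minimum of the finite spectrum.\<close>

lemma lambda_min_symmetric:
  fixes M :: "real mat"
  assumes M: "M \<in> carrier_mat k k" and sym: "M\<^sup>T = M" and k: "0 < k"
  shows "eigenvalue M (lambda_min M)"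
    and "y \<in> carrier_vec k \<Longrightarrow> lambda_min M * (y \<bullet> y) \<le> y \<bullet> (M *\<^sub>v y)"
proof -
  obtain e where e: "eigenvalue M e" "\<And>y. y \<in> carrier_vec k \<Longrightarrow> e * (y \<bullet> y) \<le> y \<bullet> (M *\<^sub>v y)"
    using symmetric_least_eigenvalue[OF M sym k] by blast
  have "lambda_min M = e"
    unfolding lambda_min_def using e eigenvalue_ge_form_bound[OF M]
    by (intro Min_eqI card_finite_spectrum[OF M]) (auto simp: spectrum_def)
  then show "eigenvalue M (lambda_min M)"
    and "y \<in> carrier_vec k \<Longrightarrow> lambda_min M * (y \<bullet> y) \<le> y \<bullet> (M *\<^sub>v y)"
    using e by auto
qed

lemma eigenvalue_uminus_iff:
  fixes M :: "real mat"
  assumes M: "M \<in> carrier_mat k k"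
  shows "eigenvalue (- M) e \<longleftrightarrow> eigenvalue M (- e)"
proof -
  have "(- M) *\<^sub>v v = e \<cdot>\<^sub>v v \<longleftrightarrow> M *\<^sub>v v = (- e) \<cdot>\<^sub>v v" if "v \<in> carrier_vec k" for v
  proof -
    have "(- M) *\<^sub>v v = - (M *\<^sub>v v)" using M that by simp
    then show ?thesis
      using M that by (auto simp: vec_eq_iff minus_equation_iff)
  qed
  then show ?thesis
    using M by (auto simp: eigenvalue_def eigenvector_def simp del: uminus_mult_mat_vec)
qed

text \<open>Passing to \<open>- M\<close> turns the largest eigenvalue into the least one.\<close>

lemma lambda_max_symmetric:
  fixes M :: "real mat"
  assumes M: "M \<in> carrier_mat k k" and sym: "M\<^sup>T = M" and k: "0 < k"
  shows "eigenvalue M (lambda_max M)"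
    and "y \<in> carrier_vec k \<Longrightarrow> y \<bullet> (M *\<^sub>v y) \<le> lambda_max M * (y \<bullet> y)"
proof -
  have M': "- M \<in> carrier_mat k k" using M by simp
  have form: "y \<bullet> ((- M) *\<^sub>v y) = - (y \<bullet> (M *\<^sub>v y))" if "y \<in> carrier_vec k" for y
    using M that by simp
  have "(- M)\<^sup>T = - M" by (simp add: transpose_uminus sym)
  then obtain e where e: "eigenvalue (- M) e"
      "\<And>y. y \<in> carrier_vec k \<Longrightarrow> e * (y \<bullet> y) \<le> y \<bullet> ((- M) *\<^sub>v y)"
    using symmetric_least_eigenvalue[OF M' _ k] by blast
  have "lambda_max M = - e"
    unfolding lambda_max_def
  proof (intro Max_eqI card_finite_spectrum[OF M])
    fix f assume "f \<in> spectrum M"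
    then have "eigenvalue (- M) (- f)" by (simp add: spectrum_def eigenvalue_uminus_iff[OF M])
    then have "e \<le> - f" using eigenvalue_ge_form_bound[OF M'] e(2) by blast
    then show "f \<le> - e" by simp
  qed (use e eigenvalue_uminus_iff[OF M] in \<open>auto simp: spectrum_def\<close>)
  then show "eigenvalue M (lambda_max M)"
    and "y \<in> carrier_vec k \<Longrightarrow> y \<bullet> (M *\<^sub>v y) \<le> lambda_max M * (y \<bullet> y)"
    using e eigenvalue_uminus_iff[OF M] form[of y] by (force, force)
qed

section \<open>Gram matrices of injective matrices\<close>

lemma eigenvalue_gram_pos:
  fixes B :: "real mat"
  assumes B: "B \<in> carrier_mat m k"
    and inj: "\<And>z. z \<in> carrier_vec k \<Longrightarrow> B *\<^sub>v z = 0\<^sub>v m \<Longrightarrow> z = 0\<^sub>v k"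
    and ev: "eigenvalue (B\<^sup>T * B) e"
  shows "0 < e"
proof -
  obtain v where v: "v \<in> carrier_vec k" "v \<noteq> 0\<^sub>v k" "(B\<^sup>T * B) *\<^sub>v v = e \<cdot>\<^sub>v v"
    using ev B by (auto simp: eigenvalue_def eigenvector_def)
  \<comment> \<open>Pairing the eigenvector equation with \<open>v\<close> equates this positive
    number with \<open>e * (v \<bullet> v)\<close>.\<close>
  have "0 < (B *\<^sub>v v) \<bullet> (B *\<^sub>v v)"
    using inj[OF v(1)] v(1,2) B by (intro scalar_prod_self_pos[of _ m]) auto
  also have "\<dots> = e * (v \<bullet> v)"
    using scalar_prod_gram[OF B v(1)] v by simp
  finally show ?thesis
    using scalar_prod_self_nonneg[of v] by (simp add: zero_less_mult_iff)
qed

text \<open>A kernel vector of the Gram matrix is one of \<open>B\<close>, since the form is the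
  squared length of \<open>B *\<^sub>v v\<close>. So the determinant is nonzero and the
  option-valued \<open>mat_inverse\<close> returns a matrix.\<close>

lemma gram_inverse:
  fixes B :: "real mat"
  assumes B: "B \<in> carrier_mat m k"
    and inj: "\<And>z. z \<in> carrier_vec k \<Longrightarrow> B *\<^sub>v z = 0\<^sub>v m \<Longrightarrow> z = 0\<^sub>v k"
  obtains N where "mat_inverse (B\<^sup>T * B) = Some N" "N \<in> carrier_mat k k" "N * (B\<^sup>T * B) = 1\<^sub>m k"
proof -
  have G: "B\<^sup>T * B \<in> carrier_mat k k" using B by simp
  have "det (B\<^sup>T * B) \<noteq> 0"
  proof
    assume "det (B\<^sup>T * B) = 0"
    then obtain v where v: "v \<in> carrier_vec k" "v \<noteq> 0\<^sub>v k" "(B\<^sup>T * B) *\<^sub>v v = 0\<^sub>v k"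
      using det_0_iff_vec_prod_zero_field[OF G] by auto
    have "(B *\<^sub>v v) \<bullet> (B *\<^sub>v v) = 0"
      using scalar_prod_gram[OF B v(1)] v by simp
    then have "B *\<^sub>v v = 0\<^sub>v m"
      using scalar_prod_self_eq_0_iff[of "B *\<^sub>v v"] B by simp
    then show False using inj v by blast
  qed
  then have "mat_inverse (B\<^sup>T * B) \<noteq> None"
    using mat_inverse(1)[OF G, of "()"] det_non_zero_imp_unit[OF G, of "()"] by blast
  then show thesis using mat_inverse(2)[OF G] that by blast
qed

section \<open>Support columns\<close>

text \<open>Linear independence concerns the set of columns, in which repeated columns would merge;
  hence distinctness is derived first.\<close>

lemma (in vec_space) rank_eq_dim_col_if_injective:
  assumes B: "B \<in> carrier_mat n k"
    and inj: "\<And>z. z \<in> carrier_vec k \<Longrightarrow> B *\<^sub>v z = 0\<^sub>v n \<Longrightarrow> z = 0\<^sub>v k"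
  shows "rank B = k"
proof (rule lin_indpt_full_rank[OF B])
  show distinct: "distinct (cols B)"
  proof (rule ccontr)
    assume "\<not> distinct (cols B)"
    then obtain i j where ij: "i < k" "j < k" "i \<noteq> j" "col B i = col B j"
      using B by (auto simp: distinct_conv_nth)
    \<comment> \<open>Two equal columns would put this nonzero vector into the kernel.\<close>
    define z where "z = (unit_vec k i - unit_vec k j :: 'a vec)"
    have z: "z \<in> carrier_vec k" by (simp add: z_def)
    have "B *\<^sub>v z = B *\<^sub>v unit_vec k i - B *\<^sub>v unit_vec k j"
      unfolding z_def by (rule mult_minus_distrib_mat_vec[OF B]) auto
    also have "\<dots> = 0\<^sub>v n"
      using B ij by (intro eq_vecI) (auto simp: vec_eq_iff)
    finally have "z = 0\<^sub>v k" using inj[OF z] by blast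
    then have "z $ i = 0" using ij by simp
    then show False using ij by (simp add: z_def)
  qed
  show "lin_indpt (set (cols B))"
    using lin_depE[OF B _ distinct] inj by metis
qed

text \<open>The inverse of the increasing enumeration counts the elements of \<open>J\<close> below
  a given one.\<close>

lemma bij_betw_pick:
  assumes "finite J"
  shows "bij_betw (pick J) {..<card J} J"
proof (rule bij_betw_byWitness[where f' = "\<lambda>i. card {a \<in> J. a < i}"])
  show "(\<lambda>i. card {a \<in> J. a < i}) ` J \<subseteq> {..<card J}"
  proof (intro image_subsetI, simp)
    fix i assume "i \<in> J"
    then have "{a \<in> J. a < i} \<subset> J" by auto
    then show "card {a \<in> J. a < i} < card J" using assms by (rule psubset_card_mono[rotated])
  qed
qed (auto simp: card_pick pick_card_in_set pick_in_set)

section \<open>Restriction of vectors and columns to an index set\<close>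

context
  fixes J :: "nat set" and n :: nat
  assumes J: "J \<subseteq> {..<n}"
begin

lemma index_set_restrict: "{i. i < n \<and> i \<in> J} = J"
  using J by auto

lemma sum_pick: "(\<Sum>l<card J. f (pick J l)) = sum f J"
  using bij_betw_pick[of J] finite_subset[OF J] by (intro sum.reindex_bij_betw) auto

lemma pick_less: "l < card J \<Longrightarrow> pick J l < n"
  using pick_le[of l n J] by (simp add: index_set_restrict)

lemma submatrix_UNIV_carrier:
  assumes "A \<in> carrier_mat m n"
  shows "submatrix A UNIV J \<in> carrier_mat m (card J)"
  using assms by (intro carrier_matI) (auto simp: dim_submatrix index_set_restrict)

lemma subvec_carrier:
  assumes "x \<in> carrier_vec n"
  shows "subvec x J \<in> carrier_vec (card J)"
  using assms by (auto simp: subvec_def index_set_restrict)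

lemma index_subvec:
  assumes "x \<in> carrier_vec n" "l < card J"
  shows "subvec x J $ l = x $ pick J l"
  using assms by (auto simp: subvec_def index_set_restrict)

text \<open>Columns outside \<open>J\<close> meet zero entries of \<open>x\<close>; the remaining
  ones are renumbered by \<open>pick J\<close>.\<close>

lemma submatrix_mult_subvec:
  fixes A :: "real mat"
  assumes A: "A \<in> carrier_mat m n" and x: "x \<in> carrier_vec n" and supp: "vec_supp x \<subseteq> J"
  shows "submatrix A UNIV J *\<^sub>v subvec x J = A *\<^sub>v x"
proof (rule eq_vecI)
  fix i assume "i < dim_vec (A *\<^sub>v x)"
  then have i: "i < m" using A by simp
  have "(submatrix A UNIV J *\<^sub>v subvec x J) $ i = (\<Sum>l<card J. A $$ (i, pick J l) * x $ pick J l)"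
    using submatrix_UNIV_carrier[OF A] subvec_carrier[OF x] i A x
    by (auto simp: scalar_prod_def atLeast0LessThan submatrix_index index_set_restrict pick_UNIV
        index_subvec intro!: sum.cong)
  also have "\<dots> = (\<Sum>j\<in>J. A $$ (i, j) * x $ j)"
    by (rule sum_pick)
  also have "\<dots> = (\<Sum>j<n. A $$ (i, j) * x $ j)"
    using J supp x by (intro sum.mono_neutral_left) (auto simp: vec_supp_def)
  also have "\<dots> = (A *\<^sub>v x) $ i"
    using A x i by (simp add: scalar_prod_def atLeast0LessThan)
  finally show "(submatrix A UNIV J *\<^sub>v subvec x J) $ i = (A *\<^sub>v x) $ i" .
qed (use submatrix_UNIV_carrier[OF A] A in auto)

text \<open>Extension by zero, used to lift kernel vectors of the submatrix to kernel vectors of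
  \<open>A\<close>.\<close>

lemma subvec_surj:
  assumes z: "z \<in> carrier_vec (card J)"
  obtains y where "y \<in> carrier_vec n" "vec_supp y \<subseteq> J" "subvec y J = z"
proof
  let ?y = "vec n (\<lambda>i. if i \<in> J then z $ card {a \<in> J. a < i} else 0)"
  show y: "?y \<in> carrier_vec n" by simp
  show "vec_supp ?y \<subseteq> J" by (auto simp: vec_supp_def split: if_splits)
  show "subvec ?y J = z"
    using subvec_carrier[OF y] z
    by (intro eq_vecI) (auto simp: index_subvec[OF y] pick_less pick_in_set card_pick)
qed

lemma scalar_prod_subvec_self:
  assumes x: "x \<in> carrier_vec n" and supp: "vec_supp x \<subseteq> J"
  shows "subvec x J \<bullet> subvec x J = x \<bullet> x"
proof -
  have "subvec x J \<bullet> subvec x J = (\<Sum>l<card J. (x $ pick J l)\<^sup>2)"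
    using subvec_carrier[OF x] by (simp add: scalar_prod_self index_subvec[OF x])
  also have "\<dots> = (\<Sum>j\<in>J. (x $ j)\<^sup>2)"
    by (rule sum_pick)
  also have "\<dots> = (\<Sum>j<n. (x $ j)\<^sup>2)"
    using J supp x by (intro sum.mono_neutral_left) (auto simp: vec_supp_def)
  finally show ?thesis using x by (simp add: scalar_prod_self)
qed

end

text \<open>Only the support contributes to the sum of squares; this is the source of the factor
  \<open>card J\<close> in the lower bound.\<close>

lemma scalar_prod_self_le_card_supp:
  "x \<bullet> x \<le> real (card (vec_supp x)) * (lq_norm \<infinity> x)\<^sup>2"
proof -
  have "x \<bullet> x = (\<Sum>j\<in>vec_supp x. (x $ j)\<^sup>2)"
    unfolding scalar_prod_self by (intro sum.mono_neutral_right) (auto simp: vec_supp_def)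
  also have "\<dots> \<le> (\<Sum>j\<in>vec_supp x. (lq_norm \<infinity> x)\<^sup>2)"
    using abs_index_le_lq_norm[of \<infinity> _ x]
    by (intro sum_mono) (auto simp: vec_supp_def abs_le_square_iff[symmetric] lq_norm_nonneg)
  finally show ?thesis by simp
qed

section \<open>Optimal solutions\<close>

text \<open>The case \<open>p = 0\<close> relies on the convention \<open>0 powr 0 = 0\<close>.\<close>

lemma lp_pow_eq_sum_powr: "lp_pow p x = (\<Sum>i<dim_vec x. \<bar>x $ i\<bar> powr p)"
proof (cases "p = 0")
  case True
  have "(\<Sum>i<dim_vec x. \<bar>x $ i\<bar> powr 0) = (\<Sum>i<dim_vec x. if x $ i \<noteq> 0 then 1 else 0)"
    by (intro sum.cong) auto
  also have "\<dots> = real (zero_norm x)"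
    by (simp add: zero_norm_def vec_supp_def sum.If_cases Int_def)
  finally show ?thesis using True by (simp add: lp_pow_def)
qed (simp add: lp_pow_def)

text \<open>The formula covers \<open>p = 0\<close> too: there the factor is 1 for
  \<open>c \<noteq> 0\<close> and 0 for \<open>c = 0\<close>.\<close>

lemma lp_pow_smult: "lp_pow p (c \<cdot>\<^sub>v x) = \<bar>c\<bar> powr p * lp_pow p x"
  by (simp add: lp_pow_eq_sum_powr sum_distrib_left abs_mult powr_mult)

lemma lp_pow_pos:
  assumes "x \<noteq> 0\<^sub>v (dim_vec x)"
  shows "0 < lp_pow p x"
proof -
  obtain i where "i < dim_vec x" "x $ i \<noteq> 0"
    using assms by (auto simp: vec_eq_iff)
  then show ?thesis
    unfolding lp_pow_eq_sum_powr by (intro sum_pos2[of _ i]) auto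
qed

text \<open>Since \<open>d\<close> is too small to change the sign of \<open>a\<close>, the two
  absolute values are \<open>\<bar>a\<bar> + d\<close> and \<open>\<bar>a\<bar> - d\<close> in some
  order.\<close>

lemma abs_powr_midpoint:
  fixes a d p :: real
  assumes "0 \<le> p" "p \<le> 1" "\<bar>d\<bar> \<le> \<bar>a\<bar>"
  shows "\<bar>a + d\<bar> powr p + \<bar>a - d\<bar> powr p \<le> 2 * \<bar>a\<bar> powr p"
proof -
  have "\<bar>a + d\<bar> = \<bar>a\<bar> + d \<and> \<bar>a - d\<bar> = \<bar>a\<bar> - d \<or> \<bar>a + d\<bar> = \<bar>a\<bar> - d \<and> \<bar>a - d\<bar> = \<bar>a\<bar> + d"
    using assms(3) by linarith
  then show ?thesis
    using powr_midpoint_concave[OF assms] by auto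
qed

text \<open>Both \<open>x + t y\<close> and \<open>x - t y\<close> keep the signs of \<open>x\<close> as long as \<open>\<bar>t y\<^sub>i\<bar> \<le> \<bar>x\<^sub>i\<bar>\<close>; for the
  largest such \<open>t\<close> an entry vanishes, and there the midpoint inequality is strict because
  \<open>2 powr p < 2\<close>.\<close>

lemma lp_pow_decrease_along_support:
  assumes p: "0 \<le> p" "p < 1"
    and x: "x \<in> carrier_vec n" and y: "y \<in> carrier_vec n"
    and supp: "vec_supp y \<subseteq> vec_supp x" and nz: "y \<noteq> 0\<^sub>v n"
  obtains t where "lp_pow p (x + t \<cdot>\<^sub>v y) < lp_pow p x"
proof -
  have fin: "finite (vec_supp y)" and ne: "vec_supp y \<noteq> {}"
    using y nz by (auto simp: vec_supp_def vec_eq_iff)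
  define t where "t = Min ((\<lambda>i. \<bar>x $ i\<bar> / \<bar>y $ i\<bar>) ` vec_supp y)"
  obtain k where k: "k \<in> vec_supp y" "t = \<bar>x $ k\<bar> / \<bar>y $ k\<bar>"
    using Min_in[of "(\<lambda>i. \<bar>x $ i\<bar> / \<bar>y $ i\<bar>) ` vec_supp y"] fin ne unfolding t_def by blast
  have t0: "0 \<le> t" using k by simp
  have small: "\<bar>t * y $ i\<bar> \<le> \<bar>x $ i\<bar>" if "i < n" for i
  proof (cases "y $ i = 0")
    case False
    then have "i \<in> vec_supp y" using that y by (auto simp: vec_supp_def)
    then have "t \<le> \<bar>x $ i\<bar> / \<bar>y $ i\<bar>" unfolding t_def using fin by (intro Min_le) auto
    then show ?thesis using False t0 by (simp add: abs_mult field_simps)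
  qed simp
  have kn: "k < n" and xk: "x $ k \<noteq> 0" and yk: "y $ k \<noteq> 0"
    using k(1) supp x y by (auto simp: vec_supp_def)
  \<comment> \<open>At the minimising index one end point has entry 0 and the other twice
    \<open>x $ k\<close>.\<close>
  have "t * y $ k = x $ k \<or> t * y $ k = - x $ k"
    using k(2) yk by (auto simp: abs_if)
  then have "\<bar>x $ k + t * y $ k\<bar> powr p + \<bar>x $ k - t * y $ k\<bar> powr p = (2 * \<bar>x $ k\<bar>) powr p"
    by (elim disjE) (auto simp flip: mult_2 simp: abs_mult)
  also have "\<dots> = 2 powr p * \<bar>x $ k\<bar> powr p"
    by (simp add: powr_mult)
  also have "\<dots> < 2 * \<bar>x $ k\<bar> powr p"
    using powr_less_mono[of p 1 "2::real"] p xk by (intro mult_strict_right_mono) auto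
  finally have strict:
    "\<bar>x $ k + t * y $ k\<bar> powr p + \<bar>x $ k - t * y $ k\<bar> powr p < 2 * \<bar>x $ k\<bar> powr p" .
  have "lp_pow p (x + t \<cdot>\<^sub>v y) + lp_pow p (x + (- t) \<cdot>\<^sub>v y)
      = (\<Sum>i<n. \<bar>x $ i + t * y $ i\<bar> powr p + \<bar>x $ i - t * y $ i\<bar> powr p)"
    using x y by (simp add: lp_pow_eq_sum_powr sum.distrib)
  also have "\<dots> < (\<Sum>i<n. 2 * \<bar>x $ i\<bar> powr p)"
    using kn strict abs_powr_midpoint[OF p(1) less_imp_le[OF p(2)] small]
    by (intro sum_strict_mono_ex1) auto
  also have "\<dots> = 2 * lp_pow p x"
    using x by (simp add: lp_pow_eq_sum_powr sum_distrib_left)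
  \<comment> \<open>The mean of the two objective values lies below the value at \<open>x\<close>,
    so one of them does.\<close>
  finally have "lp_pow p (x + t \<cdot>\<^sub>v y) < lp_pow p x \<or> lp_pow p (x + (- t) \<cdot>\<^sub>v y) < lp_pow p x"
    by linarith
  then show thesis using that by blast
qed

text \<open>A nonzero kernel vector of the support columns extends to a direction \<open>y\<close>
  with \<open>A *\<^sub>v y = 0\<close>. Moving along it keeps the residual, yet for
  \<open>p < 1\<close> some step lowers the objective.\<close>

lemma SOL_injective_on_support:
  assumes A: "A \<in> carrier_mat m n" and p: "0 \<le> p" "p < 1"
    and x: "x \<in> SOL A b \<sigma> p q"
    and z: "z \<in> carrier_vec (card (vec_supp x))"
    and Bz: "submatrix A UNIV (vec_supp x) *\<^sub>v z = 0\<^sub>v m"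
  shows "z = 0\<^sub>v (card (vec_supp x))"
proof (rule ccontr)
  let ?J = "vec_supp x"
  assume nz: "z \<noteq> 0\<^sub>v (card ?J)"
  have xn: "x \<in> carrier_vec n" and feas: "lq_norm q (A *\<^sub>v x - b) \<le> \<sigma>"
    using x A by (auto simp: SOL_def feasible_def)
  have J: "?J \<subseteq> {..<n}" using xn by (auto simp: vec_supp_def)
  obtain y where y: "y \<in> carrier_vec n" "vec_supp y \<subseteq> ?J" "subvec y ?J = z"
    using subvec_surj[OF J z] by blast
  have "y \<noteq> 0\<^sub>v n"
  proof
    assume "y = 0\<^sub>v n"
    then have "z = 0\<^sub>v (card ?J)"
      using y z by (intro eq_vecI) (auto simp: index_subvec[OF J y(1), symmetric] index_subvec[OF J] pick_less[OF J])
    then show False using nz by contradiction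
  qed
  then obtain t where t: "lp_pow p (x + t \<cdot>\<^sub>v y) < lp_pow p x"
    using lp_pow_decrease_along_support[OF p xn y(1,2)] by blast
  have Ay: "A *\<^sub>v y = 0\<^sub>v m"
    using submatrix_mult_subvec[OF J A y(1,2)] Bz y(3) by simp
  have "A *\<^sub>v (x + t \<cdot>\<^sub>v y) = A *\<^sub>v x + t \<cdot>\<^sub>v (A *\<^sub>v y)"
    using A xn y(1) by (simp add: mult_add_distrib_mat_vec[of A m n] mult_mat_vec[of A m n])
  also have "\<dots> = A *\<^sub>v x"
    using A xn Ay by (intro eq_vecI) auto
  finally have "x + t \<cdot>\<^sub>v y \<in> feasible A b \<sigma> q"
    using feas A xn y(1) by (simp add: feasible_def)
  then show False using x t by (auto simp: SOL_def not_less[symmetric])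
qed

theorem theorem2p1:
  fixes A AJ :: "real mat" and b x :: "real vec" and \<sigma> p :: real and q :: ereal
    and m n :: nat and J :: "nat set"
  assumes "A \<in> carrier_mat m n" and "b \<in> carrier_vec m"
    and "\<sigma> \<ge> 0" and "0 \<le> p" and "p \<le> 1" and "1 \<le> q" and "q \<le> \<infinity>"
    and "feasible A b \<sigma> q \<noteq> {}"
    and "lq_norm q b > \<sigma>"
    and "x \<in> SOL A b \<sigma> p q"
    and "J = vec_supp x"
    and "AJ = submatrix A UNIV J"
  shows
    "(0 < p \<longrightarrow> lq_norm q (A *\<^sub>v x - b) = \<sigma>) \<and>
     (p = 0 \<longrightarrow> (\<exists>\<alpha>::real. 0 < \<alpha> \<and> \<alpha> \<le> 1 \<and>
        lq_norm q (A *\<^sub>v (\<alpha> \<cdot>\<^sub>v x) - b) = \<sigma> \<and>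
        (\<forall>\<alpha>'. \<alpha> \<le> \<alpha>' \<and> \<alpha>' \<le> 1 \<longrightarrow> \<alpha>' \<cdot>\<^sub>v x \<in> SOL A b \<sigma> 0 q))) \<and>
     (p < 1 \<longrightarrow> zero_norm x = card J \<and> card J = vec_space.rank m AJ) \<and>
     (p < 1 \<longrightarrow>
        (lq_norm q b - \<sigma>) * real m powr min (1 / 2 - real_of_ereal (1 / q)) 0
            / sqrt (real (card J) * lambda_max (AJ\<^sup>T * AJ))
          \<le> lq_norm \<infinity> x \<and>
        lq_norm \<infinity> x
          \<le> (\<sigma> * real m powr max (1 / 2 - real_of_ereal (1 / q)) 0 + lq_norm 2 b)
              / sqrt (lambda_min (AJ\<^sup>T * AJ)) \<and>
        (\<sigma> = 0 \<longrightarrow> (\<exists>N. mat_inverse (AJ\<^sup>T * AJ) = Some N \<and>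
            subvec x J = N *\<^sub>v (AJ\<^sup>T *\<^sub>v b))))"
proof (intro conjI impI)
  note A = assms(1) and b = assms(2) and \<sigma> = assms(3) and q = assms(6) and sol = assms(10)
  have x: "x \<in> carrier_vec n" and feas: "lq_norm q (A *\<^sub>v x - b) \<le> \<sigma>"
    using sol A by (auto simp: SOL_def feasible_def)
  have opt: "lp_pow p x \<le> lp_pow p y" if "y \<in> feasible A b \<sigma> q" for y
    using sol that by (auto simp: SOL_def)
  have J: "J \<subseteq> {..<n}" and suppJ: "vec_supp x \<subseteq> J"
    using x assms(11) by (auto simp: vec_supp_def)
  have Ax: "A *\<^sub>v x \<in> carrier_vec m" using A x by simp
  have dim: "dim_vec (A *\<^sub>v x) = dim_vec b" using A b by simp
  \<comment> \<open>The zero vector has residual \<open>lq_norm q b\<close>, which exceeds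
    \<open>\<sigma>\<close>. Later this makes the objective positive and the support
    nonempty.\<close>
  have nz: "x \<noteq> 0\<^sub>v n"
  proof
    assume "x = 0\<^sub>v n"
    then have "A *\<^sub>v x = 0\<^sub>v m" using A by (intro eq_vecI) auto
    then have "lq_norm q (A *\<^sub>v x - b) = lq_norm q b"
      using b lq_norm_smult[OF q, of "- 1" b] lq_norm_diff_commute[OF q dim] by simp
    then show False using feas assms(9) by simp
  qed
  \<comment> \<open>The norm comparisons need positive dimension; in dimension 0 the norm of
    \<open>b\<close> would be 0.\<close>
  have m: "0 < m"
  proof (rule ccontr)
    assume "\<not> 0 < m"
    then have "b = 0\<^sub>v m" using b by auto
    then show False using assms(3,9) by (simp add: lq_norm_zero)
  qed
  obtain \<alpha> where \<alpha>: "0 < \<alpha>" "\<alpha> \<le> 1" "lq_norm q (\<alpha> \<cdot>\<^sub>v (A *\<^sub>v x) - b) = \<sigma>"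
    "\<And>\<alpha>'. \<alpha> \<le> \<alpha>' \<Longrightarrow> \<alpha>' \<le> 1 \<Longrightarrow> lq_norm q (\<alpha>' \<cdot>\<^sub>v (A *\<^sub>v x) - b) \<le> \<sigma>"
    using lq_norm_line_reaches_level[OF q dim assms(9) feas] by blast
  have A_smult: "A *\<^sub>v (c \<cdot>\<^sub>v x) = c \<cdot>\<^sub>v (A *\<^sub>v x)" for c
    using A x by (rule mult_mat_vec)
  have feas_smult: "c \<cdot>\<^sub>v x \<in> feasible A b \<sigma> q" if "\<alpha> \<le> c" "c \<le> 1" for c
    using \<alpha>(4)[OF that] A x by (simp add: feasible_def A_smult)
  {
    assume "0 < p"
    have pos: "0 < lp_pow p x" using nz x by (intro lp_pow_pos) auto
    \<comment> \<open>Passing to the feasible point \<open>\<alpha> \<cdot>\<^sub>v x\<close>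
      multiplies the objective by \<open>\<alpha> powr p\<close>, which is below 1 unless
      \<open>\<alpha> = 1\<close>.\<close>
    have "lp_pow p x \<le> \<alpha> powr p * lp_pow p x"
      using opt[OF feas_smult[of \<alpha>]] \<alpha> by (simp add: lp_pow_smult)
    then have "1 \<le> \<alpha> powr p" using pos by simp
    have "\<alpha> = 1"
    proof (rule ccontr)
      assume "\<alpha> \<noteq> 1"
      then have "\<alpha> powr p < 1 powr p" using \<alpha> \<open>0 < p\<close> by (intro powr_less_mono2) auto
      then show False using \<open>1 \<le> \<alpha> powr p\<close> by simp
    qed
    then show "lq_norm q (A *\<^sub>v x - b) = \<sigma>" using \<alpha>(3) by simp
  }
  {
    assume p: "p = 0"
    \<comment> \<open>A positive factor keeps the number of nonzero entries, so feasible positive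
      multiples stay optimal.\<close>
    have "c \<cdot>\<^sub>v x \<in> SOL A b \<sigma> 0 q" if c: "\<alpha> \<le> c" "c \<le> 1" for c
    proof -
      have "c > 0" using c \<alpha>(1) by simp
      then have "lp_pow 0 (c \<cdot>\<^sub>v x) = lp_pow 0 x" by (simp add: lp_pow_smult)
      then show ?thesis using feas_smult[OF c] opt p by (simp add: SOL_def)
    qed
    then show "\<exists>\<alpha>::real. 0 < \<alpha> \<and> \<alpha> \<le> 1 \<and> lq_norm q (A *\<^sub>v (\<alpha> \<cdot>\<^sub>v x) - b) = \<sigma> \<and>
        (\<forall>\<alpha>'. \<alpha> \<le> \<alpha>' \<and> \<alpha>' \<le> 1 \<longrightarrow> \<alpha>' \<cdot>\<^sub>v x \<in> SOL A b \<sigma> 0 q)"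
      using \<alpha> by (intro exI[of _ \<alpha>]) (simp add: A_smult)
  }
  show "zero_norm x = card J" using assms(11) by (simp add: zero_norm_def)
  assume p: "p < 1"
  define k where "k = card J"
  have B: "AJ \<in> carrier_mat m k"
    using submatrix_UNIV_carrier[OF J A] assms(12) by (simp add: k_def)
  have inj: "z = 0\<^sub>v k" if "z \<in> carrier_vec k" "AJ *\<^sub>v z = 0\<^sub>v m" for z
    using SOL_injective_on_support[OF A assms(4) p sol] that assms(11,12) by (simp add: k_def)
  show "card J = vec_space.rank m AJ"
    using vec_space.rank_eq_dim_col_if_injective[OF B inj] by (simp add: k_def)
  define xJ where "xJ = subvec x J"
  have xJ: "xJ \<in> carrier_vec k" and norm_xJ: "xJ \<bullet> xJ = x \<bullet> x" and BxJ: "AJ *\<^sub>v xJ = A *\<^sub>v x"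
    using subvec_carrier[OF J x] scalar_prod_subvec_self[OF J x suppJ]
      submatrix_mult_subvec[OF J A x suppJ] assms(12) by (simp_all add: xJ_def k_def)
  \<comment> \<open>Positive dimension gives the Gram matrix a nonempty spectrum, so that
    \<open>lambda_max\<close> and \<open>lambda_min\<close> are meaningful.\<close>
  have k: "0 < k"
  proof (rule ccontr)
    assume "\<not> 0 < k"
    then have "x \<bullet> x = 0" using norm_xJ xJ by (simp add: scalar_prod_self)
    then show False using nz x by (simp add: scalar_prod_self_eq_0_iff)
  qed
  have G: "AJ\<^sup>T * AJ \<in> carrier_mat k k" using B by simp
  have Gsym: "(AJ\<^sup>T * AJ)\<^sup>T = AJ\<^sup>T * AJ"
    using B by (simp add: transpose_mult[of "AJ\<^sup>T" k m AJ k])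
  note lmin = lambda_min_symmetric[OF G Gsym k] and lmax = lambda_max_symmetric[OF G Gsym k]
  have lmin_pos: "0 < lambda_min (AJ\<^sup>T * AJ)" and lmax_pos: "0 < lambda_max (AJ\<^sup>T * AJ)"
    using eigenvalue_gram_pos[OF B inj] lmin(1) lmax(1) by blast+
  have form: "xJ \<bullet> ((AJ\<^sup>T * AJ) *\<^sub>v xJ) = (A *\<^sub>v x) \<bullet> (A *\<^sub>v x)"
    using scalar_prod_gram[OF B xJ] by (simp add: BxJ)
  let ?lo = "min (1 / 2 - real_of_ereal (1 / q)) 0"
  let ?hi = "max (1 / 2 - real_of_ereal (1 / q)) 0"
  show "(lq_norm q b - \<sigma>) * real m powr ?lo / sqrt (real (card J) * lambda_max (AJ\<^sup>T * AJ))
      \<le> lq_norm \<infinity> x"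
  proof -
    \<comment> \<open>Hence \<open>A *\<^sub>v x\<close> has \<open>q\<close>-norm at least
      \<open>lq_norm q b - \<sigma>\<close>, while its Euclidean norm is bounded above through
      \<open>lambda_max\<close> and the support size.\<close>
    have "lq_norm q b \<le> lq_norm q (A *\<^sub>v x - b) + lq_norm q (A *\<^sub>v x)"
      using lq_norm_le_add_diff[OF q dim[symmetric]] lq_norm_diff_commute[OF q dim] by simp
    then have "(lq_norm q b - \<sigma>) * real m powr ?lo \<le> lq_norm q (A *\<^sub>v x) * real m powr ?lo"
      using feas by (intro mult_right_mono) auto
    also have "\<dots> \<le> lq_norm 2 (A *\<^sub>v x)"
      using lq_norm_le_lq_norm_2[OF q, of "A *\<^sub>v x"] A m by simp
    also have "\<dots> \<le> sqrt (lambda_max (AJ\<^sup>T * AJ) * (x \<bullet> x))"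
      unfolding lq_norm_2 using lmax(2)[OF xJ] form norm_xJ by simp
    also have "\<dots> \<le> sqrt (lambda_max (AJ\<^sup>T * AJ) * (real (card J) * (lq_norm \<infinity> x)\<^sup>2))"
      using scalar_prod_self_le_card_supp[of x] lmax_pos assms(11)
      by (intro real_sqrt_le_mono mult_left_mono) auto
    also have "\<dots> = lq_norm \<infinity> x * sqrt (real (card J) * lambda_max (AJ\<^sup>T * AJ))"
      by (simp add: real_sqrt_mult lq_norm_nonneg)
    finally show ?thesis
      using k lmax_pos by (subst pos_divide_le_eq) (simp_all add: k_def)
  qed
  show "lq_norm \<infinity> x \<le> (\<sigma> * real m powr ?hi + lq_norm 2 b) / sqrt (lambda_min (AJ\<^sup>T * AJ))"
  proof -
    have "\<bar>x $ i\<bar> \<le> sqrt (x \<bullet> x)" if "i < dim_vec x" for i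
      using square_index_le_scalar_prod_self[OF that] by (intro real_le_rsqrt) simp
    then have "lq_norm \<infinity> x \<le> sqrt (x \<bullet> x)"
      by (simp add: lq_norm_infinity_le_iff scalar_prod_self_nonneg)
    then have "lq_norm \<infinity> x * sqrt (lambda_min (AJ\<^sup>T * AJ))
        \<le> sqrt (x \<bullet> x) * sqrt (lambda_min (AJ\<^sup>T * AJ))"
      using lmin_pos by (intro mult_right_mono) auto
    also have "\<dots> = sqrt (lambda_min (AJ\<^sup>T * AJ) * (xJ \<bullet> xJ))"
      by (simp add: real_sqrt_mult norm_xJ)
    also have "\<dots> \<le> lq_norm 2 (A *\<^sub>v x)"
      unfolding lq_norm_2 using lmin(2)[OF xJ] form by simp
    \<comment> \<open>The triangle inequality is applied in the Euclidean norm, so that only the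
      residual picks up the power of \<open>m\<close>.\<close>
    also have "\<dots> \<le> lq_norm 2 (A *\<^sub>v x - b) + lq_norm 2 b"
      using dim by (intro lq_norm_le_add_diff) auto
    also have "lq_norm 2 (A *\<^sub>v x - b) \<le> lq_norm q (A *\<^sub>v x - b) * real m powr ?hi"
      using lq_norm_2_le_lq_norm[OF q, of "A *\<^sub>v x - b"] b m by simp
    also have "\<dots> \<le> \<sigma> * real m powr ?hi"
      using feas by (intro mult_right_mono) auto
    finally show ?thesis
      using lmin_pos by (subst pos_le_divide_eq) simp_all
  qed
  assume "\<sigma> = 0"
  then have "lq_norm q (A *\<^sub>v x - b) = 0"
    using feas lq_norm_nonneg[of q "A *\<^sub>v x - b"] by simp
  then have "A *\<^sub>v x - b = 0\<^sub>v m"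
    using lq_norm_eq_0D[OF q, of "A *\<^sub>v x - b"] b by simp
  \<comment> \<open>The system is solved exactly, so \<open>xJ\<close> satisfies the normal
    equations, which the inverse Gram matrix solves.\<close>
  then have "AJ *\<^sub>v xJ = b"
    unfolding BxJ using A Ax b by (simp add: vec_eq_iff)
  obtain N where N: "mat_inverse (AJ\<^sup>T * AJ) = Some N" "N \<in> carrier_mat k k" "N * (AJ\<^sup>T * AJ) = 1\<^sub>m k"
    using gram_inverse[OF B inj] by blast
  have "N *\<^sub>v (AJ\<^sup>T *\<^sub>v b) = N *\<^sub>v ((AJ\<^sup>T * AJ) *\<^sub>v xJ)"
    using B xJ \<open>AJ *\<^sub>v xJ = b\<close> by (simp add: assoc_mult_mat_vec[of "AJ\<^sup>T" k m AJ k xJ])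
  also have "\<dots> = (N * (AJ\<^sup>T * AJ)) *\<^sub>v xJ"
    using assoc_mult_mat_vec[OF N(2) G xJ] by simp
  also have "\<dots> = xJ"
    using N(3) xJ by simp
  finally have "subvec x J = N *\<^sub>v (AJ\<^sup>T *\<^sub>v b)"
    by (simp add: xJ_def)
  then show "\<exists>N. mat_inverse (AJ\<^sup>T * AJ) = Some N \<and> subvec x J = N *\<^sub>v (AJ\<^sup>T *\<^sub>v b)"
    using N(1) by blast
qed

end
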